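(* There is a c.e. set $A \subseteq \omega$ which is coarsely computable but not generically computable.
   Context: $\omega = \{0,1,2,\dots\}$; c.e. means computably enumerable. The density of $S \subseteq \omega$ is $\rho(S) = \lim_{n\to\infty} \frac{|S \cap [0,n]|}{n+1}$, when this limit exists. A generic description of $A$ is a partial function $\Phi$ from $\omega$ to $\{0,1\}$ such that $\Phi(x) = \chi_A(x)$ whenever $\Phi(x)$ is defined and the domain of $\Phi$ has density $1$; here $\chi_A$ is the characteristic function of $A$. $A$ is generically computable if it has a generic description which is a partial computable function. $A$ is coarsely computable if there is a computable set $C \subseteq \omega$ such that the symmetric difference $A \triangle C$ has density $0$. *)

theory Defs
  imports Complex_Main
begin

text \<open>
  Computability is defined through Kleene's partial recursive functions. Terms carry no arity
  annotation: a term denotes one partial function on the argument lists of each length, and the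
  length of a list determines the lengths of the lists passed to all subterms. On an ill-fitting
  length (for example a projection index that is out of range) the function denoted is nowhere
  defined, hence still partial recursive. Minimization and primitive recursion act on the first
  argument.
\<close>

datatype recf =
    Zero
  | Succ
  | Proj nat
  | Comp recf "recf list"
  | PrimRec recf recf
  | Mu recf

inductive rec_eval :: "recf \<Rightarrow> nat list \<Rightarrow> nat \<Rightarrow> bool" where
  zero: "rec_eval Zero xs 0"
| succ: "rec_eval Succ [x] (Suc x)"
| proj: "i < length xs \<Longrightarrow> rec_eval (Proj i) xs (xs ! i)"
| comp: "list_all2 (\<lambda>g y. rec_eval g xs y) gs ys \<Longrightarrow> rec_eval f ys z
    \<Longrightarrow> rec_eval (Comp f gs) xs z"
| primrec_0: "rec_eval f xs y \<Longrightarrow> rec_eval (PrimRec f g) (0 # xs) y"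
| primrec_Suc: "rec_eval (PrimRec f g) (n # xs) y \<Longrightarrow> rec_eval g (n # y # xs) z
    \<Longrightarrow> rec_eval (PrimRec f g) (Suc n # xs) z"
| mu: "rec_eval f (n # xs) 0 \<Longrightarrow> (\<forall>m<n. \<exists>y. rec_eval f (m # xs) (Suc y))
    \<Longrightarrow> rec_eval (Mu f) xs n"

lemma rec_eval_deterministic:
  assumes "rec_eval f xs y" and "rec_eval f xs z"
  shows "y = z"
  using assms
proof (induction arbitrary: z rule: rec_eval.induct)
  case (zero xs)
  then show ?case by (auto elim: rec_eval.cases)
next
  case (succ x)
  then show ?case by (auto elim: rec_eval.cases)
next
  case (proj i xs)
  from proj.prems show ?case by (auto elim: rec_eval.cases)
next
  case (comp xs gs ys f w)
  from comp.prems obtain ys' where ys': "list_all2 (\<lambda>g y. rec_eval g xs y) gs ys'"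
    and f: "rec_eval f ys' z"
    by (auto elim: rec_eval.cases)
  have "ys = ys'"
    using comp.IH(1) ys' by (auto simp: list_all2_conv_all_nth intro!: nth_equalityI)
  with f comp.IH(2) show ?case by blast
next
  case (primrec_0 f xs y g)
  from primrec_0.prems show ?case
    by (cases rule: rec_eval.cases) (use primrec_0.IH in auto)
next
  case (primrec_Suc f g n xs y w)
  from primrec_Suc.prems show ?case
    by (cases rule: rec_eval.cases) (use primrec_Suc.IH in blast)
next
  case (mu f n xs)
  from mu.prems obtain "rec_eval f (z # xs) 0" "\<forall>m<z. \<exists>y. rec_eval f (m # xs) (Suc y)"
    by (auto elim: rec_eval.cases)
  with mu.IH show ?case
    by (metis linorder_neqE_nat nat.distinct(1))
qed

definition partial_computable :: "(nat \<rightharpoonup> nat) \<Rightarrow> bool" where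
  "partial_computable \<phi> \<longleftrightarrow> (\<exists>f. \<forall>x y. \<phi> x = Some y \<longleftrightarrow> rec_eval f [x] y)"

definition char_fun :: "nat set \<Rightarrow> nat \<Rightarrow> nat" where
  "char_fun A x = (if x \<in> A then 1 else 0)"

definition computable_set :: "nat set \<Rightarrow> bool" where
  "computable_set A \<longleftrightarrow> partial_computable (\<lambda>x. Some (char_fun A x))"

definition ce_set :: "nat set \<Rightarrow> bool" where
  "ce_set A \<longleftrightarrow> (\<exists>\<phi>. partial_computable \<phi> \<and> A = dom \<phi>)"

definition has_density :: "nat set \<Rightarrow> real \<Rightarrow> bool" where
  "has_density S d \<longleftrightarrow> (\<lambda>n. real (card (S \<inter> {0..n})) / real (n + 1)) \<longlonglongrightarrow> d"

definition generic_description :: "nat set \<Rightarrow> (nat \<rightharpoonup> nat) \<Rightarrow> bool" where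
  "generic_description A \<Phi> \<longleftrightarrow>
     ran \<Phi> \<subseteq> {0, 1} \<and> (\<forall>x\<in>dom \<Phi>. \<Phi> x = Some (char_fun A x)) \<and> has_density (dom \<Phi>) 1"

definition generically_computable :: "nat set \<Rightarrow> bool" where
  "generically_computable A \<longleftrightarrow> (\<exists>\<Phi>. generic_description A \<Phi> \<and> partial_computable \<Phi>)"

definition coarsely_computable :: "nat set \<Rightarrow> bool" where
  "coarsely_computable A \<longleftrightarrow>
     (\<exists>C. computable_set C \<and> has_density (sym_diff A C) 0)"

end

theory Submission
  imports Defs "HOL-Library.Nat_Bijection"
begin

text \<open>
  The set is Post's simple set, made sparse. A set \<open>A\<close> of density \<open>0\<close> is coarsely computable, since
  it agrees with the empty set up to density \<open>0\<close>. Suppose that such an \<open>A\<close> also meets every infinite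
  c.e. set. If \<open>\<Phi>\<close> were a partial computable generic description of \<open>A\<close>, then the c.e. set
  \<open>{x. \<Phi> x = Some 0}\<close> would be disjoint from \<open>A\<close>, hence finite, and the domain of \<open>\<Phi>\<close>, which is
  contained in the union of \<open>A\<close> and this finite set, would have density \<open>0\<close> instead of \<open>1\<close>
  (\<open>not_generically_computable_density_0\<close>). To build \<open>A\<close>, search for each program \<open>e\<close> for an input
  \<open>x \<ge> e\<^sup>2\<close> on which \<open>e\<close> returns \<open>0\<close>, and put the first \<open>x\<close> that turns up into \<open>A\<close>. An infinite c.e.
  set has elements above every \<open>e\<^sup>2\<close>, so it is met (\<open>sparse_simple_meets\<close>); and \<open>A\<close> has at most
  \<open>sqrt n + 1\<close> elements up to \<open>n\<close>, so its density is \<open>0\<close> (\<open>density_sparse_simple\<close>).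

  That \<open>A\<close> is c.e. rests on a universal enumeration of the partial recursive functions. For this
  the graph of evaluation is presented as the closure of a finite list of rules on natural numbers:
  each rule derives one coded fact, such as ``program \<open>f\<close> on the list \<open>xs\<close> returns \<open>y\<close>'', from at most
  two others, and premises and conclusion are recursive functions of the parameters of the rule. The
  closure of such a system can be enumerated by primitive recursion on a stage number, where the finite
  set of facts derived so far is stored in the bits of a single number (\<open>derivable_iff_stage\<close>,
  \<open>recursive_stage\<close>). The rules derive an evaluation fact exactly if it holds (\<open>eval_fact_iff\<close>), so
  ``\<open>e\<close> has been seen by stage \<open>t\<close> to return \<open>0\<close> on \<open>x\<close>'' is decidable, and so is being the first
  witness found for \<open>e\<close>.
\<close>

section \<open>Total recursive functions\<close>

text \<open>The arity is explicit because one program denotes functions of all arities, and may be total for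
  one arity and nowhere defined for another.\<close>

definition recursive :: "nat \<Rightarrow> (nat list \<Rightarrow> nat) \<Rightarrow> bool" where
  "recursive k F \<longleftrightarrow> (\<exists>f. \<forall>xs. length xs = k \<longrightarrow> rec_eval f xs (F xs))"

abbreviation recursive1 :: "(nat \<Rightarrow> nat) \<Rightarrow> bool" where
  "recursive1 h \<equiv> recursive 1 (\<lambda>xs. h (xs ! 0))"

abbreviation recursive2 :: "(nat \<Rightarrow> nat \<Rightarrow> nat) \<Rightarrow> bool" where
  "recursive2 h \<equiv> recursive 2 (\<lambda>xs. h (xs ! 0) (xs ! 1))"

abbreviation decidable :: "nat \<Rightarrow> (nat list \<Rightarrow> bool) \<Rightarrow> bool" where
  "decidable k P \<equiv> recursive k (\<lambda>xs. of_bool (P xs))"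

lemma recursive_nth: "i < k \<Longrightarrow> recursive k (\<lambda>xs. xs ! i)"
  unfolding recursive_def by (metis rec_eval.proj)

lemma recursive_comp:
  assumes "recursive k F" and "\<And>i. i < k \<Longrightarrow> recursive m (g i)"
  shows "recursive m (\<lambda>xs. F (map (\<lambda>i. g i xs) [0..<k]))"
proof -
  obtain f where f: "\<And>xs. length xs = k \<Longrightarrow> rec_eval f xs (F xs)"
    using assms(1) unfolding recursive_def by blast
  obtain h where h: "\<And>i xs. i < k \<Longrightarrow> length xs = m \<Longrightarrow> rec_eval (h i) xs (g i xs)"
    using assms(2) unfolding recursive_def by metis
  have "rec_eval (Comp f (map h [0..<k])) xs (F (map (\<lambda>i. g i xs) [0..<k]))"
    if "length xs = m" for xs
    by (rule rec_eval.comp[OF _ f]) (auto simp: list_all2_conv_all_nth h that)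
  then show ?thesis unfolding recursive_def by blast
qed

lemma recursive_comp1:
  assumes "recursive1 h" and "recursive k G"
  shows "recursive k (\<lambda>xs. h (G xs))"
  using recursive_comp[OF assms(1), of k "\<lambda>_. G"] assms(2) by simp

lemma recursive_comp2:
  assumes "recursive2 h" and "recursive k G" and "recursive k H"
  shows "recursive k (\<lambda>xs. h (G xs) (H xs))"
  using recursive_comp[OF assms(1), of k "\<lambda>i. if i = 0 then G else H"] assms(2,3)
  by (simp add: upt_rec numeral_2_eq_2)

lemma recursive_Suc:
  assumes "recursive k F"
  shows "recursive k (\<lambda>xs. Suc (F xs))"
proof (rule recursive_comp1[OF _ assms])
  have "rec_eval Succ xs (Suc (xs ! 0))" if "length xs = 1" for xs
    using that by (cases xs) (auto intro: rec_eval.succ)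
  then show "recursive1 Suc" unfolding recursive_def by blast
qed

lemma recursive_const: "recursive k (\<lambda>_. c)"
proof (induction c)
  case 0
  show ?case unfolding recursive_def by (metis rec_eval.zero)
qed (rule recursive_Suc)

lemma recursive_rec_nat:
  assumes "recursive1 F" and "recursive 3 (\<lambda>xs. G (xs ! 0) (xs ! 1) (xs ! 2))"
    and "recursive k N" and "recursive k X"
  shows "recursive k (\<lambda>xs. rec_nat (F (X xs)) (\<lambda>m y. G m y (X xs)) (N xs))"
proof (rule recursive_comp2[where h = "\<lambda>n x. rec_nat (F x) (\<lambda>m y. G m y x) n", OF _ assms(3,4)])
  obtain f where f: "\<And>xs. length xs = 1 \<Longrightarrow> rec_eval f xs (F (xs ! 0))"
    using assms(1) unfolding recursive_def by blast
  obtain g where g: "\<And>xs. length xs = 3 \<Longrightarrow> rec_eval g xs (G (xs ! 0) (xs ! 1) (xs ! 2))"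
    using assms(2) unfolding recursive_def by blast
  have "rec_eval (PrimRec f g) (n # [x]) (rec_nat (F x) (\<lambda>m y. G m y x) n)" for n x
  proof (induction n)
    case 0
    show ?case using f[of "[x]"] by (auto intro: rec_eval.primrec_0)
  next
    case (Suc n)
    show ?case
      using rec_eval.primrec_Suc[OF Suc g] by simp
  qed
  then have "rec_eval (PrimRec f g) xs (rec_nat (F (xs ! 1)) (\<lambda>m y. G m y (xs ! 1)) (xs ! 0))"
    if "length xs = 2" for xs
    using that by (auto simp: numeral_2_eq_2 length_Suc_conv)
  then show "recursive2 (\<lambda>n x. rec_nat (F x) (\<lambda>m y. G m y x) n)"
    unfolding recursive_def by blast
qed

text \<open>The case without a parameter: \<open>PrimRec\<close> is run with a dummy one, whose value is \<open>0\<close>.\<close>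

lemma recursive_rec_nat_closed:
  assumes "recursive 3 (\<lambda>xs. G (xs ! 0) (xs ! 1))" and "recursive k N"
  shows "recursive k (\<lambda>xs. rec_nat c G (N xs))"
  using recursive_rec_nat[OF recursive_const, of "\<lambda>m y _. G m y", OF assms recursive_const[of k 0]] .

lemma recursive_add:
  assumes "recursive k F" and "recursive k G"
  shows "recursive k (\<lambda>xs. F xs + G xs)"
proof -
  have "rec_nat x (\<lambda>_ y. Suc y) n = n + x" for n x by (induction n) auto
  moreover have "recursive k (\<lambda>xs. rec_nat (G xs) (\<lambda>_ y. Suc y) (F xs))"
    by (rule recursive_rec_nat[where F = "\<lambda>x. x", OF _ _ assms])
      (auto intro!: recursive_nth recursive_Suc)
  ultimately show ?thesis by simp
qed

lemma recursive_mult: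
  assumes "recursive k F" and "recursive k G"
  shows "recursive k (\<lambda>xs. F xs * G xs)"
proof -
  have "rec_nat 0 (\<lambda>_ y. y + x) n = n * x" for n x by (induction n) auto
  moreover have "recursive k (\<lambda>xs. rec_nat 0 (\<lambda>_ y. y + G xs) (F xs))"
    by (rule recursive_rec_nat[where F = "\<lambda>_. 0", OF _ _ assms])
      (auto intro!: recursive_nth recursive_const recursive_add)
  ultimately show ?thesis by simp
qed

lemma recursive_diff:
  assumes "recursive k F" and "recursive k G"
  shows "recursive k (\<lambda>xs. F xs - G xs)"
proof -
  have pred: "recursive m (\<lambda>xs. H xs - 1)" if "recursive m H" for m H
  proof -
    have "rec_nat 0 (\<lambda>m _. m) n = n - 1" for n by (cases n) auto
    moreover have "recursive m (\<lambda>xs. rec_nat 0 (\<lambda>m _. m) (H xs))"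
      by (rule recursive_rec_nat_closed[OF _ that]) (auto intro!: recursive_nth)
    ultimately show ?thesis by simp
  qed
  have "rec_nat x (\<lambda>_ y. y - 1) n = x - n" for n x by (induction n) auto
  moreover have "recursive k (\<lambda>xs. rec_nat (F xs) (\<lambda>_ y. y - 1) (G xs))"
    by (rule recursive_rec_nat[where F = "\<lambda>x. x", OF _ _ assms(2,1)])
      (intro pred recursive_nth; simp)+
  ultimately show ?thesis by simp
qed

lemma recursive_power2:
  assumes "recursive k F"
  shows "recursive k (\<lambda>xs. 2 ^ F xs)"
proof -
  have "rec_nat 1 (\<lambda>_ y. 2 * y) n = (2 ^ n :: nat)" for n by (induction n) auto
  moreover have "recursive k (\<lambda>xs. rec_nat 1 (\<lambda>_ y. 2 * y) (F xs))"
    by (rule recursive_rec_nat_closed[OF _ assms])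
      (intro recursive_mult recursive_const recursive_nth; simp)
  ultimately show ?thesis by simp
qed

lemma decidable_not:
  assumes "decidable k P"
  shows "decidable k (\<lambda>xs. \<not> P xs)"
proof -
  have "of_bool (\<not> b) = 1 - (of_bool b :: nat)" for b by auto
  then show ?thesis using assms by (simp only:) (intro recursive_diff recursive_const)
qed

lemma decidable_conj:
  assumes "decidable k P" and "decidable k Q"
  shows "decidable k (\<lambda>xs. P xs \<and> Q xs)"
  unfolding of_bool_conj using assms by (rule recursive_mult)

lemma decidable_le:
  assumes "recursive k F" and "recursive k G"
  shows "decidable k (\<lambda>xs. F xs \<le> G xs)"
proof -
  have "of_bool (a \<le> b) = 1 - (a - b)" for a b :: nat by auto
  then show ?thesis using assms by (simp only:) (intro recursive_diff recursive_const)
qed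

lemma recursive_if:
  assumes "decidable k P" and "recursive k F" and "recursive k G"
  shows "recursive k (\<lambda>xs. if P xs then F xs else G xs)"
proof -
  have "(if b then x else y) = of_bool b * x + (1 - of_bool b) * y" for b and x y :: nat by auto
  then show ?thesis
    using assms by (simp only:) (intro recursive_add recursive_mult recursive_diff recursive_const)
qed

lemma decidable_all_less:
  assumes "decidable 2 (\<lambda>xs. P (xs ! 0) (xs ! 1))" and "recursive k N" and "recursive k X"
  shows "decidable k (\<lambda>xs. \<forall>v < N xs. P (X xs) v)"
proof -
  have "rec_nat 1 (\<lambda>m y. y * of_bool (P x m)) n = (of_bool (\<forall>v < n. P x v) :: nat)"
    for x and n :: nat by (induction n) (auto simp: less_Suc_eq)
  moreover have "recursive k (\<lambda>xs. rec_nat 1 (\<lambda>m y. y * of_bool (P (X xs) m)) (N xs))"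
    by (rule recursive_rec_nat[where F = "\<lambda>_. 1", OF _ _ assms(2,3)])
      (intro recursive_const recursive_mult recursive_nth recursive_comp2[OF assms(1)]; simp)+
  ultimately show ?thesis by simp
qed

section \<open>Recursive pairing and finite sets as bit patterns\<close>

abbreviation pair :: "nat \<Rightarrow> nat \<Rightarrow> nat" where
  "pair a b \<equiv> prod_encode (a, b)"

definition pair_fst :: "nat \<Rightarrow> nat" where
  "pair_fst z = fst (prod_decode z)"

definition pair_snd :: "nat \<Rightarrow> nat" where
  "pair_snd z = snd (prod_decode z)"

lemma pair_fst_pair [simp]: "pair_fst (pair a b) = a"
  and pair_snd_pair [simp]: "pair_snd (pair a b) = b"
  by (simp_all add: pair_fst_def pair_snd_def)

lemma recursive_triangle:
  assumes "recursive k F"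
  shows "recursive k (\<lambda>xs. triangle (F xs))"
proof -
  have "rec_nat 0 (\<lambda>m y. y + Suc m) n = triangle n" for n by (induction n) auto
  moreover have "recursive k (\<lambda>xs. rec_nat 0 (\<lambda>m y. y + Suc m) (F xs))"
    by (rule recursive_rec_nat_closed[OF _ assms])
      (intro recursive_add recursive_Suc recursive_nth; simp)
  ultimately show ?thesis by simp
qed

lemma recursive_pair:
  assumes "recursive k F" and "recursive k G"
  shows "recursive k (\<lambda>xs. pair (F xs) (G xs))"
  unfolding prod_encode_def prod.case
  using assms by (intro recursive_add recursive_triangle)

text \<open>The number \<open>z\<close> lies on the diagonal \<open>a + b\<close> of Cantor's enumeration of pairs, and this diagonal
  is found by recursion on \<open>z\<close>: it moves on exactly when \<open>z\<close> reaches the next triangular number.\<close>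

definition diagonal :: "nat \<Rightarrow> nat" where
  "diagonal = rec_nat 0 (\<lambda>z s. if triangle (Suc s) \<le> Suc z then Suc s else s)"

lemma diagonal_bounds: "triangle (diagonal z) \<le> z \<and> z < triangle (Suc (diagonal z))"
  by (induction z) (auto simp: diagonal_def)

lemma diagonal_pair: "diagonal (pair a b) = a + b"
proof -
  have mono: "triangle m \<le> triangle n" if "m \<le> n" for m n
    using that by (rule lift_Suc_mono_le[rotated]) simp
  let ?z = "pair a b"
  have z: "triangle (a + b) \<le> ?z" "?z < triangle (Suc (a + b))"
    by (auto simp: prod_encode_def)
  have "\<not> Suc (a + b) \<le> diagonal ?z" "\<not> Suc (diagonal ?z) \<le> a + b"
    using diagonal_bounds[of ?z] z mono by (meson leD le_trans less_le_trans)+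
  then show ?thesis by simp
qed

lemma recursive_unpair:
  assumes "recursive k F"
  shows recursive_pair_fst: "recursive k (\<lambda>xs. pair_fst (F xs))"
    and recursive_pair_snd: "recursive k (\<lambda>xs. pair_snd (F xs))"
proof -
  have diag: "recursive k (\<lambda>xs. diagonal (F xs))"
    unfolding diagonal_def
    by (rule recursive_rec_nat_closed[OF _ assms])
      (intro recursive_if decidable_le recursive_triangle recursive_Suc recursive_nth; simp)
  have fst: "pair_fst z = z - triangle (diagonal z)" for z
  proof (cases "prod_decode z")
    case (Pair a b)
    then have "z = pair a b" by (metis prod_decode_inverse)
    then show ?thesis by (simp add: diagonal_pair) (simp add: prod_encode_def)
  qed
  have snd: "pair_snd z = diagonal z - pair_fst z" for z
  proof (cases "prod_decode z")
    case (Pair a b)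
    then have "z = pair a b" by (metis prod_decode_inverse)
    then show ?thesis by (simp add: diagonal_pair)
  qed
  show fst_rec: "recursive k (\<lambda>xs. pair_fst (F xs))"
    unfolding fst by (intro recursive_diff recursive_triangle diag assms)
  show "recursive k (\<lambda>xs. pair_snd (F xs))"
    unfolding snd by (intro recursive_diff diag fst_rec)
qed

lemma decidable_bit:
  assumes "recursive k F" and "recursive k G"
  shows "decidable k (\<lambda>xs. bit (F xs) (G xs))"
proof -
  \<comment> \<open>Bit \<open>i\<close> of \<open>n\<close> is the parity after \<open>i\<close> halvings, and halving itself is a primitive recursion
    because \<open>Suc m div 2 = m - m div 2\<close>.\<close>
  have half: "recursive m (\<lambda>xs. H xs div 2)" if "recursive m H" for m H
  proof -
    have "rec_nat 0 (\<lambda>m y. m - y) n = n div 2" for n :: nat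
    proof (induction n)
      case (Suc n)
      have "n - n div 2 = Suc n div 2" by presburger
      with Suc show ?case by simp
    qed simp
    moreover have "recursive m (\<lambda>xs. rec_nat 0 (\<lambda>m y. m - y) (H xs))"
      by (rule recursive_rec_nat_closed[OF _ that]) (intro recursive_diff recursive_nth; simp)
    ultimately show ?thesis by simp
  qed
  have parity: "decidable m (\<lambda>xs. odd (H xs))" if "recursive m H" for m H
  proof -
    have "rec_nat 0 (\<lambda>m y. 1 - y) n = (of_bool (odd n) :: nat)" for n by (induction n) auto
    moreover have "recursive m (\<lambda>xs. rec_nat 0 (\<lambda>m y. 1 - y) (H xs))"
      by (rule recursive_rec_nat_closed[OF _ that])
        (intro recursive_diff recursive_const recursive_nth; simp)
    ultimately show ?thesis by simp
  qed
  have shift: "rec_nat x (\<lambda>_ y. y div 2) n = x div 2 ^ n" for x n :: nat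
    by (induction n) (auto simp: div_mult2_eq[symmetric] mult.commute)
  have "recursive k (\<lambda>xs. rec_nat (F xs) (\<lambda>_ y. y div 2) (G xs))"
    by (rule recursive_rec_nat[where F = "\<lambda>x. x", OF _ _ assms(2,1)])
      (intro half recursive_nth; simp)+
  then have "decidable k (\<lambda>xs. odd (F xs div 2 ^ G xs))"
    unfolding shift by (rule parity)
  then show ?thesis by (simp add: bit_iff_odd)
qed

lemma recursive_set_bit:
  assumes "recursive k F" and "recursive k G"
  shows "recursive k (\<lambda>xs. set_bit (F xs) (G xs))"
proof -
  have "set_bit n a = (if bit a n then a else a + 2 ^ n)" for n a :: nat
    by (simp add: set_bit_eq)
  then show ?thesis
    using assms by (simp only:) (intro recursive_if decidable_bit recursive_add recursive_power2)
qed

section \<open>Enumerating the closure of a finite system of rules\<close>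

text \<open>The \<open>k\<close>-tuple coded by \<open>t\<close> as \<open>\<langle>x\<^sub>0, \<langle>x\<^sub>1, \<dots>\<rangle>\<rangle>\<close> with arbitrary remainder, so that every number
  codes a tuple of every length.\<close>

definition tuple :: "nat \<Rightarrow> nat \<Rightarrow> nat list" where
  "tuple k t = map (\<lambda>i. pair_fst ((pair_snd ^^ i) t)) [0..<k]"

lemma length_tuple [simp]: "length (tuple k t) = k"
  by (simp add: tuple_def)

lemma tuple_surj: "\<exists>t. tuple (length xs) t = xs"
proof (induction xs)
  case Nil
  show ?case by (simp add: tuple_def)
next
  case (Cons x xs)
  then obtain t where "tuple (length xs) t = xs" by blast
  then have "tuple (length (x # xs)) (pair x t) = x # xs"
    by (simp add: tuple_def map_upt_Suc funpow_Suc_right del: upt_Suc funpow.simps)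
  then show ?case by blast
qed

lemma recursive_tuple:
  assumes "recursive k F" and "recursive m G"
  shows "recursive m (\<lambda>xs. F (tuple k (G xs)))"
proof -
  have "recursive m (\<lambda>xs. (pair_snd ^^ i) (G xs))" for i
    by (induction i) (auto intro: assms(2) recursive_pair_snd)
  then show ?thesis
    unfolding tuple_def by (intro recursive_comp[OF assms(1)] recursive_pair_fst)
qed

text \<open>A rule consists of two premises and a conclusion, given as functions of the parameters. The fact
  \<open>0\<close> is always derivable, and it serves as the premise of rules that need fewer than two.\<close>

type_synonym rule = "(nat list \<Rightarrow> nat) \<times> (nat list \<Rightarrow> nat) \<times> (nat list \<Rightarrow> nat)"

inductive_set derivable :: "nat \<Rightarrow> rule list \<Rightarrow> nat set" for k rs where
  start: "0 \<in> derivable k rs"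
| step: "(p, q, c) \<in> set rs \<Longrightarrow> length xs = k \<Longrightarrow> p xs \<in> derivable k rs \<Longrightarrow> q xs \<in> derivable k rs
    \<Longrightarrow> c xs \<in> derivable k rs"

primrec fire :: "rule list \<Rightarrow> nat list \<Rightarrow> nat \<Rightarrow> nat" where
  "fire [] xs S = S"
| "fire (r # rs) xs S = fire rs xs (case r of (p, q, c) \<Rightarrow>
     if bit S (p xs) \<and> bit S (q xs) then set_bit (c xs) S else S)"

text \<open>Stage \<open>t + 1\<close> applies every rule once, to the parameters coded by the second component of \<open>t\<close>. The
  first component is padding: it makes each choice of parameters come up again at arbitrarily late
  stages, after both premises have been derived. Stage \<open>0\<close> is the bit pattern of the set \<open>{0}\<close>.\<close>

definition stage :: "nat \<Rightarrow> rule list \<Rightarrow> nat \<Rightarrow> nat" where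
  "stage k rs = rec_nat 1 (\<lambda>t S. fire rs (tuple k (pair_snd t)) S)"

lemma stage_0: "stage k rs 0 = 1"
  and stage_Suc: "stage k rs (Suc t) = fire rs (tuple k (pair_snd t)) (stage k rs t)"
  by (simp_all add: stage_def)

lemma fire_mono: "bit S x \<Longrightarrow> bit (fire rs xs S) x"
  by (induction rs arbitrary: S) (auto simp: bit_set_bit_iff)

lemma fire_conclusion:
  assumes "(p, q, c) \<in> set rs" and "bit S (p xs)" and "bit S (q xs)"
  shows "bit (fire rs xs S) (c xs)"
  using assms
proof (induction rs arbitrary: S)
  case (Cons r rs)
  show ?case
  proof (cases "r = (p, q, c)")
    case True
    then show ?thesis using Cons.prems by (simp add: bit_set_bit_iff fire_mono)
  next
    case False
    then show ?thesis
      using Cons.prems by (auto simp: bit_set_bit_iff split: prod.split intro!: Cons.IH)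
  qed
qed simp

lemma fire_sound:
  assumes "set rs \<subseteq> set rs'" and "length xs = k" and "\<And>x. bit S x \<Longrightarrow> x \<in> derivable k rs'"
    and "bit (fire rs xs S) x"
  shows "x \<in> derivable k rs'"
  using assms
proof (induction rs arbitrary: S)
  case (Cons r rs)
  obtain p q c where r: "r = (p, q, c)" by (cases r) auto
  let ?S = "if bit S (p xs) \<and> bit S (q xs) then set_bit (c xs) S else S"
  show ?case
  proof (rule Cons.IH[of ?S])
    fix x assume "bit ?S x"
    then show "x \<in> derivable k rs'"
      using Cons.prems(1-3) r derivable.step[of p q c rs' xs k]
      by (auto simp: bit_set_bit_iff split: if_splits)
  qed (use Cons.prems r in auto)
qed simp

lemma stage_mono:
  assumes "s \<le> t" and "bit (stage k rs s) x"
  shows "bit (stage k rs t) x"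
  using assms by (induction rule: dec_induct) (auto simp: stage_Suc fire_mono)

lemma derivable_iff_stage: "x \<in> derivable k rs \<longleftrightarrow> (\<exists>t. bit (stage k rs t) x)"
proof
  assume "x \<in> derivable k rs"
  then show "\<exists>t. bit (stage k rs t) x"
  proof induction
    case start
    have "bit (stage k rs 0) 0" by (simp add: stage_0 bit_1_iff del: One_nat_def)
    then show ?case ..
  next
    case (step p q c xs)
    then obtain t u where "bit (stage k rs t) (p xs)" "bit (stage k rs u) (q xs)" by blast
    moreover obtain v where v: "tuple k v = xs" using tuple_surj step.hyps(2) by blast
    \<comment> \<open>A stage with the wanted parameters that is late enough for both premises.\<close>
    moreover define w where "w = pair (max t u) v"
    moreover have "max t u \<le> w" unfolding w_def by (rule le_prod_encode_1)
    ultimately have "bit (stage k rs w) (p xs)" "bit (stage k rs w) (q xs)" "tuple k (pair_snd w) = xs"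
      by (auto intro: stage_mono)
    then have "bit (stage k rs (Suc w)) (c xs)"
      using fire_conclusion[OF step.hyps(1)] by (simp add: stage_Suc)
    then show ?case ..
  qed
next
  have "bit (stage k rs t) x \<Longrightarrow> x \<in> derivable k rs" for t
  proof (induction t arbitrary: x)
    case 0
    then have "x = 0" by (simp only: stage_0 bit_1_iff)
    then show ?case by (simp only: derivable.start)
  next
    case (Suc t)
    then show ?case by (metis fire_sound length_tuple order_refl stage_Suc)
  qed
  then show "\<exists>t. bit (stage k rs t) x \<Longrightarrow> x \<in> derivable k rs" by blast
qed

lemma recursive_fire:
  assumes "\<forall>(p, q, c) \<in> set rs. recursive k p \<and> recursive k q \<and> recursive k c"
    and "recursive m T" and "recursive m S"
  shows "recursive m (\<lambda>xs. fire rs (tuple k (T xs)) (S xs))"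
  using assms(1,3)
proof (induction rs arbitrary: S)
  case (Cons r rs)
  obtain p q c where r: "r = (p, q, c)" by (cases r) auto
  show ?case
    unfolding r fire.simps prod.case using Cons.prems r
    by (intro Cons.IH recursive_if decidable_conj decidable_bit recursive_set_bit
        recursive_tuple assms(2)) auto
qed simp

lemma recursive_stage:
  assumes "\<forall>(p, q, c) \<in> set rs. recursive k p \<and> recursive k q \<and> recursive k c"
    and "recursive m T"
  shows "recursive m (\<lambda>xs. stage k rs (T xs))"
  unfolding stage_def
  by (intro recursive_rec_nat_closed[OF _ assms(2)] recursive_fire[OF assms(1)]
      recursive_pair_snd recursive_nth; simp)

section \<open>Rules for the evaluation of partial recursive functions\<close>

primrec code :: "recf \<Rightarrow> nat" where
  "code Zero = pair 0 0"
| "code Succ = pair 1 0"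
| "code (Proj i) = pair 2 i"
| "code (Comp f gs) = pair 3 (pair (code f) (list_encode (map code gs)))"
| "code (PrimRec f g) = pair 4 (pair (code f) (code g))"
| "code (Mu f) = pair 5 (code f)"

abbreviation cons :: "nat \<Rightarrow> nat \<Rightarrow> nat" where
  "cons x l \<equiv> Suc (pair x l)"

text \<open>Facts are tagged triples. Read with coded programs and lists,
  \<^item> \<open>eval_fact f xs y\<close> says that \<open>f\<close> on \<open>xs\<close> returns \<open>y\<close>;
  \<^item> \<open>args_fact gs xs ys\<close> says that the programs \<open>gs\<close> on \<open>xs\<close> return the values \<open>ys\<close>;
  \<^item> \<open>nth_fact xs i y\<close> says that \<open>y\<close> is entry \<open>i\<close> of \<open>xs\<close>;
  \<^item> \<open>pos_fact f n xs\<close> says that \<open>f\<close> is defined and positive on \<open>m # xs\<close> for all \<open>m < n\<close>.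

  The last three break the premises of composition, projection and minimization, which refer to whole
  lists or to all \<open>m < n\<close>, into steps with at most two premises. The successor keeps all facts distinct
  from the axiom \<open>0\<close>.\<close>

definition fact :: "nat \<Rightarrow> nat \<Rightarrow> nat \<Rightarrow> nat \<Rightarrow> nat" where
  "fact i a b c = Suc (pair i (pair a (pair b c)))"

lemma fact_eq_iff [simp]:
  "fact i a b c = fact i' a' b' c' \<longleftrightarrow> i = i' \<and> a = a' \<and> b = b' \<and> c = c'"
  by (simp add: fact_def)

lemma fact_neq_0 [simp]: "fact i a b c \<noteq> 0"
  by (simp add: fact_def)

abbreviation eval_fact :: "nat \<Rightarrow> nat \<Rightarrow> nat \<Rightarrow> nat" where
  "eval_fact \<equiv> fact 0"

abbreviation args_fact :: "nat \<Rightarrow> nat \<Rightarrow> nat \<Rightarrow> nat" where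
  "args_fact \<equiv> fact 2"

abbreviation nth_fact :: "nat \<Rightarrow> nat \<Rightarrow> nat \<Rightarrow> nat" where
  "nth_fact \<equiv> fact 3"

abbreviation pos_fact :: "nat \<Rightarrow> nat \<Rightarrow> nat \<Rightarrow> nat" where
  "pos_fact \<equiv> fact 4"

definition eval_rules :: "rule list" where
  "eval_rules = [
    (\<lambda>_. 0, \<lambda>_. 0, \<lambda>v. eval_fact (pair 0 0) (v!0) 0),
    (\<lambda>_. 0, \<lambda>_. 0, \<lambda>v. eval_fact (pair 1 0) (cons (v!0) 0) (Suc (v!0))),
    (\<lambda>_. 0, \<lambda>_. 0, \<lambda>v. nth_fact (cons (v!0) (v!1)) 0 (v!0)),
    (\<lambda>v. nth_fact (v!1) (v!2) (v!3), \<lambda>_. 0, \<lambda>v. nth_fact (cons (v!0) (v!1)) (Suc (v!2)) (v!3)),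
    (\<lambda>v. nth_fact (v!1) (v!0) (v!2), \<lambda>_. 0, \<lambda>v. eval_fact (pair 2 (v!0)) (v!1) (v!2)),
    (\<lambda>_. 0, \<lambda>_. 0, \<lambda>v. args_fact 0 (v!0) 0),
    (\<lambda>v. eval_fact (v!0) (v!2) (v!3), \<lambda>v. args_fact (v!1) (v!2) (v!4),
     \<lambda>v. args_fact (cons (v!0) (v!1)) (v!2) (cons (v!3) (v!4))),
    (\<lambda>v. args_fact (v!1) (v!2) (v!3), \<lambda>v. eval_fact (v!0) (v!3) (v!4),
     \<lambda>v. eval_fact (pair 3 (pair (v!0) (v!1))) (v!2) (v!4)),
    (\<lambda>v. eval_fact (v!0) (v!2) (v!3), \<lambda>_. 0,
     \<lambda>v. eval_fact (pair 4 (pair (v!0) (v!1))) (cons 0 (v!2)) (v!3)),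
    (\<lambda>v. eval_fact (pair 4 (pair (v!0) (v!1))) (cons (v!3) (v!2)) (v!4),
     \<lambda>v. eval_fact (v!1) (cons (v!3) (cons (v!4) (v!2))) (v!5),
     \<lambda>v. eval_fact (pair 4 (pair (v!0) (v!1))) (cons (Suc (v!3)) (v!2)) (v!5)),
    (\<lambda>_. 0, \<lambda>_. 0, \<lambda>v. pos_fact (v!0) 0 (v!1)),
    (\<lambda>v. pos_fact (v!0) (v!1) (v!2), \<lambda>v. eval_fact (v!0) (cons (v!1) (v!2)) (Suc (v!3)),
     \<lambda>v. pos_fact (v!0) (Suc (v!1)) (v!2)),
    (\<lambda>v. eval_fact (v!0) (cons (v!1) (v!2)) 0, \<lambda>v. pos_fact (v!0) (v!1) (v!2),
     \<lambda>v. eval_fact (pair 5 (v!0)) (v!2) (v!1))]"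

lemma recursive_eval_rules:
  "\<forall>(p, q, c) \<in> set eval_rules. recursive 6 p \<and> recursive 6 q \<and> recursive 6 c"
  unfolding eval_rules_def fact_def
  by (simp, intro conjI recursive_Suc recursive_pair recursive_const recursive_nth; simp)

abbreviation facts :: "nat set" where
  "facts \<equiv> derivable 6 eval_rules"

text \<open>Parameter lists have length \<open>6\<close> because the successor step of primitive recursion has six
  parameters. For the other rules the list is filled up with zeros.\<close>

lemma facts_rule:
  assumes "i < length eval_rules" and "eval_rules ! i = (p, q, c)" and "length xs = 6"
    and "p xs \<in> facts" and "q xs \<in> facts"
  shows "c xs \<in> facts"
  using assms derivable.step nth_mem by metis

lemma facts_Zero: "eval_fact (pair 0 0) x 0 \<in> facts"
  using facts_rule[of 0 _ _ _ "[x,0,0,0,0,0]"] by (simp add: eval_rules_def derivable.start)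

lemma facts_Succ: "eval_fact (pair 1 0) (cons x 0) (Suc x) \<in> facts"
  using facts_rule[of 1 _ _ _ "[x,0,0,0,0,0]"] by (simp add: eval_rules_def derivable.start)

lemma facts_nth_0: "nth_fact (cons x l) 0 x \<in> facts"
  using facts_rule[of 2 _ _ _ "[x,l,0,0,0,0]"] by (simp add: eval_rules_def derivable.start)

lemma facts_nth_Suc: "nth_fact l i y \<in> facts \<Longrightarrow> nth_fact (cons x l) (Suc i) y \<in> facts"
  using facts_rule[of 3 _ _ _ "[x,l,i,y,0,0]"] by (simp add: eval_rules_def derivable.start)

lemma facts_Proj: "nth_fact l i y \<in> facts \<Longrightarrow> eval_fact (pair 2 i) l y \<in> facts"
  using facts_rule[of 4 _ _ _ "[i,l,y,0,0,0]"] by (simp add: eval_rules_def derivable.start)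

lemma facts_args_Nil: "args_fact 0 l 0 \<in> facts"
  using facts_rule[of 5 _ _ _ "[l,0,0,0,0,0]"] by (simp add: eval_rules_def derivable.start)

lemma facts_args_Cons:
  "eval_fact g l y \<in> facts \<Longrightarrow> args_fact gs l ys \<in> facts \<Longrightarrow> args_fact (cons g gs) l (cons y ys) \<in> facts"
  using facts_rule[of 6 _ _ _ "[g,gs,l,y,ys,0]"] by (simp add: eval_rules_def derivable.start)

lemma facts_Comp:
  "args_fact gs l ys \<in> facts \<Longrightarrow> eval_fact f ys z \<in> facts \<Longrightarrow> eval_fact (pair 3 (pair f gs)) l z \<in> facts"
  using facts_rule[of 7 _ _ _ "[f,gs,l,ys,z,0]"] by (simp add: eval_rules_def derivable.start)

lemma facts_PrimRec_0:
  "eval_fact f l y \<in> facts \<Longrightarrow> eval_fact (pair 4 (pair f g)) (cons 0 l) y \<in> facts"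
  using facts_rule[of 8 _ _ _ "[f,g,l,y,0,0]"] by (simp add: eval_rules_def derivable.start)

lemma facts_PrimRec_Suc:
  "eval_fact (pair 4 (pair f g)) (cons n l) y \<in> facts \<Longrightarrow> eval_fact g (cons n (cons y l)) z \<in> facts
    \<Longrightarrow> eval_fact (pair 4 (pair f g)) (cons (Suc n) l) z \<in> facts"
  using facts_rule[of 9 _ _ _ "[f,g,l,n,y,z]"] by (simp add: eval_rules_def derivable.start)

lemma facts_pos_0: "pos_fact f 0 l \<in> facts"
  using facts_rule[of 10 _ _ _ "[f,l,0,0,0,0]"] by (simp add: eval_rules_def derivable.start)

lemma facts_pos_Suc:
  "pos_fact f n l \<in> facts \<Longrightarrow> eval_fact f (cons n l) (Suc y) \<in> facts \<Longrightarrow> pos_fact f (Suc n) l \<in> facts"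
  using facts_rule[of 11 _ _ _ "[f,n,l,y,0,0]"] by (simp add: eval_rules_def derivable.start)

lemma facts_Mu:
  "eval_fact f (cons n l) 0 \<in> facts \<Longrightarrow> pos_fact f n l \<in> facts \<Longrightarrow> eval_fact (pair 5 f) l n \<in> facts"
  using facts_rule[of 12 _ _ _ "[f,n,l,0,0,0]"] by (simp add: eval_rules_def derivable.start)

lemma facts_nth: "i < length xs \<Longrightarrow> nth_fact (list_encode xs) i (xs ! i) \<in> facts"
proof (induction xs arbitrary: i)
  case (Cons x xs)
  then show ?case by (cases i) (auto intro: facts_nth_0 facts_nth_Suc)
qed simp

lemma facts_complete:
  "rec_eval f xs y \<Longrightarrow> eval_fact (code f) (list_encode xs) y \<in> facts"
proof (induction rule: rec_eval.induct)
  case (comp xs gs ys f z)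
  from comp.IH(1) have "args_fact (list_encode (map code gs)) (list_encode xs) (list_encode ys) \<in> facts"
    by (induction rule: list_all2_induct) (auto intro: facts_args_Nil facts_args_Cons)
  then show ?case using comp.IH(2) by (auto intro: facts_Comp)
next
  case (mu f n xs)
  have "pos_fact (code f) m (list_encode xs) \<in> facts" if "m \<le> n" for m
    using that
  proof (induction m)
    case 0
    show ?case by (rule facts_pos_0)
  next
    case (Suc m)
    then obtain y where "eval_fact (code f) (cons m (list_encode xs)) (Suc y) \<in> facts"
      using mu.IH(2) by (auto simp: Suc_le_eq)
    with Suc show ?case by (auto intro: facts_pos_Suc)
  qed
  then show ?case using mu.IH(1) by (auto intro: facts_Mu)
qed (use facts_Zero facts_Succ in \<open>auto intro: facts_Proj facts_nth facts_PrimRec_0 facts_PrimRec_Suc\<close>)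

text \<open>The parameters of a rule range over all numbers, so that facts about numbers which code no program
  are derivable too. Soundness therefore constrains only those facts whose components are codes; this
  is inductive because a composite number is the code of a program only if its parts are.\<close>

definition true_fact :: "nat \<Rightarrow> bool" where
  "true_fact c \<longleftrightarrow>
     (\<forall>f xs y. c = eval_fact (code f) (list_encode xs) y \<longrightarrow> rec_eval f xs y) \<and>
     (\<forall>gs xs ys. c = args_fact (list_encode (map code gs)) (list_encode xs) (list_encode ys)
        \<longrightarrow> list_all2 (\<lambda>g y. rec_eval g xs y) gs ys) \<and>
     (\<forall>xs i y. c = nth_fact (list_encode xs) i y \<longrightarrow> i < length xs \<and> xs ! i = y) \<and>
     (\<forall>f n xs. c = pos_fact (code f) n (list_encode xs)
        \<longrightarrow> (\<forall>m<n. \<exists>y. rec_eval f (m # xs) (Suc y)))"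

lemma true_fact_simps:
  "true_fact 0"
  "true_fact (eval_fact a l y) \<longleftrightarrow>
     (\<forall>f xs. a = code f \<and> l = list_encode xs \<longrightarrow> rec_eval f xs y)"
  "true_fact (args_fact a l m) \<longleftrightarrow>
     (\<forall>gs xs ys. a = list_encode (map code gs) \<and> l = list_encode xs \<and> m = list_encode ys
        \<longrightarrow> list_all2 (\<lambda>g y. rec_eval g xs y) gs ys)"
  "true_fact (nth_fact l i y) \<longleftrightarrow> (\<forall>xs. l = list_encode xs \<longrightarrow> i < length xs \<and> xs ! i = y)"
  "true_fact (pos_fact a n l) \<longleftrightarrow>
     (\<forall>f xs. a = code f \<and> l = list_encode xs \<longrightarrow> (\<forall>m<n. \<exists>y. rec_eval f (m # xs) (Suc y)))"
  by (auto simp: true_fact_def fact_neq_0[symmetric] simp del: fact_neq_0)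

lemma code_eq_iff:
  "pair 0 0 = code f \<longleftrightarrow> f = Zero"
  "pair (Suc 0) 0 = code f \<longleftrightarrow> f = Succ"
  "pair 2 a = code f \<longleftrightarrow> f = Proj a"
  "pair 3 (pair a b) = code f \<longleftrightarrow>
     (\<exists>f' gs. f = Comp f' gs \<and> a = code f' \<and> b = list_encode (map code gs))"
  "pair 4 (pair a b) = code f \<longleftrightarrow> (\<exists>f' g. f = PrimRec f' g \<and> a = code f' \<and> b = code g)"
  "pair 5 a = code f \<longleftrightarrow> (\<exists>f'. f = Mu f' \<and> a = code f')"
  by (cases f; simp; metis)+

lemma list_encode_eq_iff:
  "0 = list_encode xs \<longleftrightarrow> xs = []"
  "cons a b = list_encode xs \<longleftrightarrow> (\<exists>xs'. xs = a # xs' \<and> b = list_encode xs')"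
  by (cases xs; auto)+

lemma facts_sound: "c \<in> facts \<Longrightarrow> true_fact c"
proof (induction rule: derivable.induct)
  case start
  show ?case by (rule true_fact_simps)
next
  case (step p q c v)
  \<comment> \<open>The composition rule has the list of intermediate values as parameter \<open>3\<close>. It does not occur in
    the conclusion, so that it is a code of a list only because every number is.\<close>
  obtain ys where "v ! 3 = list_encode ys" by (metis list_decode_inverse)
  with step.hyps(1) step.IH show ?case
    unfolding eval_rules_def
    apply simp
    apply (elim disjE conjE; simp add: true_fact_simps code_eq_iff list_encode_eq_iff;
        (auto simp: list_encode_eq map_eq_Cons_conv less_Suc_eq intro: rec_eval.intros; fail)?)
    \<comment> \<open>Left are projection, the successor step of primitive recursion, and the extension of a
      positivity fact from \<open>n\<close> to \<open>Suc n\<close>.\<close>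
    subgoal using rec_eval.proj by metis
    subgoal using rec_eval.primrec_Suc by metis
    subgoal by (auto 0 4 simp: less_Suc_eq)
    done
qed

lemma eval_fact_iff: "eval_fact (code f) (list_encode xs) y \<in> facts \<longleftrightarrow> rec_eval f xs y"
  using facts_complete facts_sound[of "eval_fact (code f) (list_encode xs) y"]
  by (auto simp: true_fact_simps)

section \<open>Computably enumerable sets\<close>

text \<open>The projection is the domain of the function that searches for the least \<open>u\<close>. As \<open>Mu\<close> looks for a
  zero, it is applied to the characteristic function of the negation.\<close>

lemma ce_set_projection:
  assumes "decidable 2 (\<lambda>xs. P (xs ! 0) (xs ! 1))"
  shows "ce_set {x. \<exists>u. P u x}"
proof -
  have "decidable 2 (\<lambda>xs. \<not> P (xs ! 0) (xs ! 1))" using assms by (rule decidable_not)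
  then obtain f where
    f: "\<And>xs. length xs = 2 \<Longrightarrow> rec_eval f xs (of_bool (\<not> P (xs ! 0) (xs ! 1)))"
    unfolding recursive_def by blast
  have f_iff: "rec_eval f [u, x] y \<longleftrightarrow> y = of_bool (\<not> P u x)" for u x y
    using f[of "[u, x]"] rec_eval_deterministic by auto
  define \<phi> where "\<phi> x = (if \<exists>u. P u x then Some (LEAST u. P u x) else None)" for x
  have "\<phi> x = Some y \<longleftrightarrow> rec_eval (Mu f) [x] y" for x y
  proof -
    have "rec_eval (Mu f) [x] y \<longleftrightarrow> P y x \<and> (\<forall>m<y. \<not> P m x)"
      by (subst rec_eval.simps) (auto simp: f_iff)
    also have "\<dots> \<longleftrightarrow> \<phi> x = Some y"
      unfolding \<phi>_def by (auto intro: Least_equality LeastI dest: not_less_Least) (metis not_less Least_equality)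
    finally show ?thesis by simp
  qed
  then have "partial_computable \<phi>" unfolding partial_computable_def by blast
  moreover have "{x. \<exists>u. P u x} = dom \<phi>" by (auto simp: \<phi>_def dom_def)
  ultimately show ?thesis unfolding ce_set_def by blast
qed

section \<open>Sets of density zero\<close>

lemma has_density_0_mono:
  assumes "has_density A 0" and "finite B" and "S \<subseteq> A \<union> B"
  shows "has_density S 0"
  unfolding has_density_def
proof (rule tendsto_sandwich[OF _ _ tendsto_const])
  show "\<forall>\<^sub>F n in sequentially. 0 \<le> real (card (S \<inter> {0..n})) / real (n + 1)" by simp
  have "card (S \<inter> {0..n}) \<le> card (A \<inter> {0..n}) + card B" for n
  proof -
    have "card (S \<inter> {0..n}) \<le> card ((A \<inter> {0..n}) \<union> B)"
      using assms(2,3) by (intro card_mono) auto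
    then show ?thesis using card_Un_le le_trans by blast
  qed
  then have "real (card (S \<inter> {0..n})) / real (n + 1)
      \<le> real (card (A \<inter> {0..n})) / real (n + 1) + real (card B) * inverse (real (Suc n))" for n
    by (simp add: divide_inverse flip: distrib_right of_nat_add)
  then show "\<forall>\<^sub>F n in sequentially. real (card (S \<inter> {0..n})) / real (n + 1)
      \<le> real (card (A \<inter> {0..n})) / real (n + 1) + real (card B) * inverse (real (Suc n))"
    by simp
  show "(\<lambda>n. real (card (A \<inter> {0..n})) / real (n + 1) + real (card B) * inverse (real (Suc n)))
      \<longlonglongrightarrow> 0"
    using tendsto_add[OF assms(1)[unfolded has_density_def]
        tendsto_mult[OF tendsto_const LIMSEQ_inverse_real_of_nat]] by simp
qed

text \<open>Choosing an \<open>e\<close> with \<open>R e x\<close> for every \<open>x \<in> A\<close> is injective and maps the elements up to \<open>n\<close> to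
  numbers whose square is at most \<open>n\<close>, so there are at most \<open>sqrt n + 1\<close> of them.\<close>

lemma has_density_0_sparse:
  assumes "\<And>x. x \<in> A \<Longrightarrow> \<exists>e. R e x" and "\<And>e x. R e x \<Longrightarrow> e * e \<le> x"
    and "\<And>e x y. R e x \<Longrightarrow> R e y \<Longrightarrow> x = y"
  shows "has_density A 0"
  unfolding has_density_def
proof (rule tendsto_sandwich[OF _ _ tendsto_const])
  show "\<forall>\<^sub>F n in sequentially. 0 \<le> real (card (A \<inter> {0..n})) / real (n + 1)" by simp
  obtain r where r: "\<And>x. x \<in> A \<Longrightarrow> R (r x) x" using assms(1) by metis
  have bound: "real (card (A \<inter> {0..n})) / real (n + 1) \<le> 2 * sqrt (inverse (real (Suc n)))" for n
  proof -
    define s where "s = nat \<lfloor>sqrt n\<rfloor>"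
    have "card (A \<inter> {0..n}) \<le> card {..s}"
    proof (rule card_inj_on_le)
      show "inj_on r (A \<inter> {0..n})" by (rule inj_onI) (metis IntD1 r assms(3))
      show "r ` (A \<inter> {0..n}) \<subseteq> {..s}"
      proof safe
        fix x assume "x \<in> A" "x \<in> {0..n}"
        then have "(r x)\<^sup>2 \<le> n" using assms(2)[OF r[of x]] by (simp add: power2_eq_square)
        then have "real (r x) \<le> sqrt n" by (intro real_le_rsqrt) (metis of_nat_le_iff of_nat_power)
        then show "r x \<le> s" by (simp add: s_def le_nat_floor)
      qed
    qed simp
    then have "real (card (A \<inter> {0..n})) \<le> real s + 1" by simp
    also have "\<dots> \<le> sqrt n + 1" by (simp add: s_def of_nat_floor)
    also have "\<dots> \<le> 2 * sqrt (Suc n)"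
    proof -
      have "sqrt n \<le> sqrt (Suc n)" "1 \<le> sqrt (Suc n)" by simp_all
      then show ?thesis by linarith
    qed
    finally have "real (card (A \<inter> {0..n})) / real (Suc n) \<le> 2 * sqrt (Suc n) / real (Suc n)"
      by (intro divide_right_mono) auto
    also have "\<dots> = 2 * sqrt (inverse (real (Suc n)))"
    proof -
      have "a / b = inverse a" if "a * a = b" "a \<noteq> 0" for a b :: real
        using that by (auto simp: field_simps)
      from this[of "sqrt (Suc n)" "Suc n"] show ?thesis by (simp add: real_sqrt_inverse)
    qed
    finally show ?thesis by simp
  qed
  then show "\<forall>\<^sub>F n in sequentially. real (card (A \<inter> {0..n})) / real (n + 1)
      \<le> 2 * sqrt (inverse (real (Suc n)))" by (rule always_eventually[OF allI])
  show "(\<lambda>n. 2 * sqrt (inverse (real (Suc n)))) \<longlonglongrightarrow> 0"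
    using tendsto_mult[OF tendsto_const tendsto_real_sqrt[OF LIMSEQ_inverse_real_of_nat]] by simp
qed

lemma coarsely_computable_density_0:
  assumes "has_density A 0"
  shows "coarsely_computable A"
proof -
  have "(0::nat) = y \<longleftrightarrow> rec_eval Zero [x] y" for x y
    using rec_eval_deterministic rec_eval.zero by blast
  then have "computable_set {}"
    unfolding computable_set_def partial_computable_def by (auto simp: char_fun_def)
  then show ?thesis
    unfolding coarsely_computable_def using assms by (intro exI[of _ "{}"]) simp
qed

text \<open>A generic description \<open>\<Phi>\<close> takes the value \<open>1\<close> only on \<open>A\<close>, which is negligible, and the value
  \<open>0\<close> only on a c.e. set that avoids \<open>A\<close>, which must be finite.\<close>

lemma not_generically_computable_density_0:
  assumes "has_density A 0"
    and "\<And>f. infinite {x. rec_eval f [x] 0} \<Longrightarrow> \<exists>x\<in>A. rec_eval f [x] 0"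
  shows "\<not> generically_computable A"
proof
  assume "generically_computable A"
  then obtain \<Phi> f where gen: "\<And>x. x \<in> dom \<Phi> \<Longrightarrow> \<Phi> x = Some (char_fun A x)"
    and dens: "has_density (dom \<Phi>) 1" and f: "\<And>x y. \<Phi> x = Some y \<longleftrightarrow> rec_eval f [x] y"
    unfolding generically_computable_def generic_description_def partial_computable_def by blast
  have "\<not> rec_eval f [x] 0" if "x \<in> A" for x
    using gen[OF domI, of x 0] f[of x 0] that by (auto simp: char_fun_def)
  then have "finite {x. rec_eval f [x] 0}" using assms(2) by blast
  moreover have "dom \<Phi> \<subseteq> A \<union> {x. rec_eval f [x] 0}"
  proof
    fix x assume "x \<in> dom \<Phi>"
    then have "rec_eval f [x] (char_fun A x)" using gen f by blast
    then show "x \<in> A \<union> {x. rec_eval f [x] 0}" by (auto simp: char_fun_def split: if_splits)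
  qed
  ultimately have "has_density (dom \<Phi>) 0" by (rule has_density_0_mono[OF assms(1)])
  then show False using dens LIMSEQ_unique unfolding has_density_def by force
qed

section \<open>A sparse simple set\<close>

text \<open>A witness \<open>w = \<langle>x, t\<rangle>\<close> for the program code \<open>e\<close> consists of an input and a stage. The lower bound
  \<open>e\<^sup>2\<close> for the input is what makes the set sparse. The number \<open>cons x 0\<close> codes the list \<open>[x]\<close>.\<close>

definition found :: "nat \<Rightarrow> nat \<Rightarrow> bool" where
  "found e w \<longleftrightarrow> e * e \<le> pair_fst w \<and>
     bit (stage 6 eval_rules (pair_snd w)) (eval_fact e (cons (pair_fst w) 0) 0)"

definition first_found :: "nat \<Rightarrow> nat \<Rightarrow> bool" where
  "first_found e w \<longleftrightarrow> found e w \<and> (\<forall>v<w. \<not> found e v)"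

definition sparse_simple :: "nat set" where
  "sparse_simple = {x. \<exists>e t. first_found e (pair x t)}"

lemma first_found_unique: "first_found e v \<Longrightarrow> first_found e w \<Longrightarrow> v = w"
  unfolding first_found_def by (metis linorder_neqE_nat)

lemma found_imp_rec_eval: "found (code f) w \<Longrightarrow> rec_eval f [pair_fst w] 0"
  using eval_fact_iff[of f "[pair_fst w]" 0] derivable_iff_stage by (auto simp: found_def)

text \<open>That no earlier witness exists is decidable since ``earlier'' is a bounded quantifier over coded
  witnesses; this is why input and stage are searched for jointly.\<close>

lemma ce_sparse_simple: "ce_set sparse_simple"
proof -
  have found: "decidable k (\<lambda>xs. found (E xs) (W xs))" if "recursive k E" "recursive k W" for k E W
    unfolding found_def fact_def using that
    by (intro decidable_conj decidable_le recursive_mult recursive_pair_fst decidable_bit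
        recursive_stage[OF recursive_eval_rules] recursive_pair_snd recursive_Suc recursive_pair
        recursive_const)
  have "decidable 2 (\<lambda>xs. first_found (pair_fst (xs ! 0)) (pair (xs ! 1) (pair_snd (xs ! 0))))"
    unfolding first_found_def
    by (intro decidable_conj found decidable_all_less[where P = "\<lambda>x v. \<not> found x v"] decidable_not
        recursive_pair recursive_pair_fst recursive_pair_snd recursive_nth; simp)
  moreover have "sparse_simple = {x. \<exists>u. first_found (pair_fst u) (pair x (pair_snd u))}"
    unfolding sparse_simple_def by (auto, metis pair_fst_pair pair_snd_pair)
  ultimately show ?thesis
    using ce_set_projection[of "\<lambda>u x. first_found (pair_fst u) (pair x (pair_snd u))"] by simp
qed

lemma density_sparse_simple: "has_density sparse_simple 0"
proof (rule has_density_0_sparse[where R = "\<lambda>e x. \<exists>t. first_found e (pair x t)"])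
  show "x = y" if "\<exists>t. first_found e (pair x t)" "\<exists>t. first_found e (pair y t)" for e x y
    using that first_found_unique by (metis pair_fst_pair)
qed (auto simp: sparse_simple_def first_found_def found_def)

text \<open>If \<open>f\<close> has infinitely many zeros, one of them exceeds the bound for \<open>f\<close>, so the search for \<open>f\<close>
  succeeds; what it finds first may be another zero of \<open>f\<close>, and that one is in the set.\<close>

lemma sparse_simple_meets:
  assumes "infinite {x. rec_eval f [x] 0}"
  shows "\<exists>x\<in>sparse_simple. rec_eval f [x] 0"
proof -
  obtain x where x: "rec_eval f [x] 0" "code f * code f \<le> x"
    using assms by (auto simp: finite_nat_set_iff_bounded not_less)
  then obtain t where "bit (stage 6 eval_rules t) (eval_fact (code f) (list_encode [x]) 0)"
    using eval_fact_iff derivable_iff_stage by blast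
  then have "found (code f) (pair x t)" using x by (simp add: found_def)
  then obtain w where w: "first_found (code f) w"
    unfolding first_found_def by (metis exists_least_iff)
  have "w = pair (pair_fst w) (pair_snd w)" by (simp add: pair_fst_def pair_snd_def)
  with w have "pair_fst w \<in> sparse_simple" unfolding sparse_simple_def by (metis mem_Collect_eq)
  moreover have "rec_eval f [pair_fst w] 0" using w found_imp_rec_eval by (simp add: first_found_def)
  ultimately show ?thesis ..
qed

theorem proposition2p15:
  "\<exists>A :: nat set. ce_set A \<and> coarsely_computable A \<and> \<not> generically_computable A"
  using ce_sparse_simple coarsely_computable_density_0[OF density_sparse_simple]
    not_generically_computable_density_0[OF density_sparse_simple sparse_simple_meets]
  by blast

end
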